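(* Assume that $l:\mathbb{R}\to\mathbb{R}$ is a $\mathcal{C}^2$-function, that $h$ is a $\mathcal{C}^2$-function with respect to $\theta$, and that $\nabla_\theta h(\theta,x)$, $\nabla_\theta^2h(\theta,x)$ and the eigenvalues of the latter matrix are uniformly bounded on $\Theta\times\mathcal{X}$. Then for every $\mu\in\mathcal{P}_2$ and every $\xi\in L^2(\mu)$, $\mathcal{L}_S((id+\xi)_\sharp\mu)$ can be represented as $$\mathcal{L}_S((id+\xi)_\sharp\mu)=\mathcal{L}_S(\mu)+\mathbb{E}_\mu\big[\mathbb{E}_S[s_\mu(\theta,x,y)]^\top\xi(\theta)\big]+\frac12H_\mu(\xi)+o(\|\xi\|_{L^2(\mu)}^2),$$ where $H_\mu(\xi)=O(\|\xi\|_{L^2(\mu)}^2)$ is given, for some $\theta'$ which is a convex combination of $\theta$ and $\theta+\xi(\theta)$ depending also on $x$, by $$H_\mu(\xi)=-\mathbb{E}_S\Big[y\,l'(-yh_\mu(x))\,\mathbb{E}_\mu\big[\|\xi(\theta)\|^2_{\nabla_\theta^2h(\theta',x)}\big]\Big]+\mathbb{E}_S\Big[l''(-yh_\mu(x))\big(\mathbb{E}_\mu[\nabla_\theta h(\theta,x)^\top\xi(\theta)]\big)^2\Big].$$ The $o$ and $O$ terms are as $\|\xi\|_{L^2(\mu)}\to0$.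
   Context: $\Theta=\mathbb{R}^d$, $\mathcal{X}\subset\mathbb{R}^n$ is Borel, $\mathcal{Y}=\{-1,1\}$; $h:\Theta\times\mathcal{X}\to[-1,1]$ is Borel measurable and continuous in $x$; $l:\mathbb{R}\to\mathbb{R}$ is a loss function. $S=\{(x_j,y_j)\}_{j=1}^N\subset\mathcal{X}\times\mathcal{Y}$ is a fixed finite dataset and $\mathbb{E}_S$ is the average over $S$ (in the variables $(x,y)$). $\mathcal{P}_2$ is the set of Borel probability measures on $\Theta$ with finite second moment. For a probability measure $\mu$, $h_\mu(x)=\mathbb{E}_{\theta\sim\mu}[h(\theta,x)]$ and $\mathcal{L}_S(\mu)=\frac1N\sum_{j=1}^Nl(-y_jh_\mu(x_j))$. $L^2(\mu)$ is the space of square-$\mu$-integrable maps from $\mathrm{supp}(\mu)$ into $\Theta$, with inner product $\langle\xi,\zeta\rangle_{L^2(\mu)}=\mathbb{E}_\mu[\xi(\theta)^\top\zeta(\theta)]$. $\phi_\sharp\mu(\mathcal{A})=\mu(\phi^{-1}(\mathcal{A}))$ is the push-forward, and $id$ is the identity map. $s_\mu(\theta,x,y)=-l'(-yh_\mu(x))\,y\,\nabla_\theta h(\theta,x)$. For a symmetric matrix $A$, $\|v\|_A^2=v^\top Av$. *)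

theory Defs
  imports "HOL-Probability.Probability" "HOL-Library.Landau_Symbols"
begin

definition grad :: "(real^'d \<Rightarrow> real) \<Rightarrow> real^'d \<Rightarrow> real^'d" where
  "grad f \<theta> = (THE D. GDERIV f \<theta> :> D)"

definition hess :: "(real^'d \<Rightarrow> real) \<Rightarrow> real^'d \<Rightarrow> real^'d^'d" where
  "hess f \<theta> = jacobian (grad f) (at \<theta>)"

definition C2_multi :: "(real^'d \<Rightarrow> real) \<Rightarrow> bool" where
  "C2_multi f \<longleftrightarrow>
     (\<forall>\<theta>. f differentiable (at \<theta>)) \<and>
     (\<forall>\<theta>. grad f differentiable (at \<theta>)) \<and>
     continuous_on UNIV (hess f)"

definition C2_real :: "(real \<Rightarrow> real) \<Rightarrow> bool" where
  "C2_real l \<longleftrightarrow>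
     (\<forall>t. l differentiable (at t)) \<and>
     (\<forall>t. deriv l differentiable (at t)) \<and>
     continuous_on UNIV (deriv (deriv l))"

definition is_eigenvalue :: "real^'d^'d \<Rightarrow> real \<Rightarrow> bool" where
  "is_eigenvalue A c \<longleftrightarrow> (\<exists>v. v \<noteq> 0 \<and> A *v v = c *\<^sub>R v)"

definition norm_sq_wrt :: "real^'d^'d \<Rightarrow> real^'d \<Rightarrow> real" where
  "norm_sq_wrt A v = v \<bullet> (A *v v)"

definition P2 :: "(real^'d) measure set" where
  "P2 = {\<mu>. prob_space \<mu> \<and> sets \<mu> = sets borel \<and> integrable \<mu> (\<lambda>\<theta>. (norm \<theta>)\<^sup>2)}"

definition supp :: "(real^'d) measure \<Rightarrow> (real^'d) set" where
  "supp \<mu> = {\<theta>. \<forall>U. open U \<and> \<theta> \<in> U \<longrightarrow> emeasure \<mu> U > 0}"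

text \<open>
  Maps that are only given on the support of \<open>\<mu>\<close> are rendered as total functions whose values
  outside \<open>supp \<mu>\<close> are never used: measurability, integrals and push-forwards of such maps are taken
  with respect to the measure space \<open>on_supp \<mu>\<close>, whose underlying set is \<open>supp \<mu>\<close>.
\<close>

definition on_supp :: "(real^'d) measure \<Rightarrow> (real^'d) measure" where
  "on_supp \<mu> = restrict_space \<mu> (supp \<mu>)"

definition L2 :: "(real^'d) measure \<Rightarrow> (real^'d \<Rightarrow> real^'d) set" where
  "L2 \<mu> = {\<xi>. \<xi> \<in> borel_measurable (on_supp \<mu>) \<and> integrable (on_supp \<mu>) (\<lambda>\<theta>. (norm (\<xi> \<theta>))\<^sup>2)}"

definition L2_inner :: "(real^'d) measure \<Rightarrow> (real^'d \<Rightarrow> real^'d) \<Rightarrow> (real^'d \<Rightarrow> real^'d) \<Rightarrow> real" where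
  "L2_inner \<mu> \<xi> \<zeta> = (LINT \<theta>|on_supp \<mu>. \<xi> \<theta> \<bullet> \<zeta> \<theta>)"

definition L2_norm :: "(real^'d) measure \<Rightarrow> (real^'d \<Rightarrow> real^'d) \<Rightarrow> real" where
  "L2_norm \<mu> \<xi> = sqrt (L2_inner \<mu> \<xi> \<xi>)"

text \<open>Maps of norm zero are included in the limit \<open>L2_norm \<mu> \<xi> \<rightarrow> 0\<close>, since \<open>L2\<close> consists of representatives.\<close>

definition L2_to_0 :: "(real^'d) measure \<Rightarrow> (real^'d \<Rightarrow> real^'d) filter" where
  "L2_to_0 \<mu> = inf (filtercomap (L2_norm \<mu>) (nhds 0)) (principal (L2 \<mu>))"

definition push_forward :: "(real^'d \<Rightarrow> real^'d) \<Rightarrow> (real^'d) measure \<Rightarrow> (real^'d) measure" where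
  "push_forward \<phi> \<mu> = distr (on_supp \<mu>) borel \<phi>"

text \<open>Only the entries \<open>S 1, \<dots>, S N\<close> are used; repeated data points are allowed.\<close>

definition data_avg :: "nat \<Rightarrow> (nat \<Rightarrow> 'x \<times> real) \<Rightarrow> ('x \<Rightarrow> real \<Rightarrow> 'v::real_vector) \<Rightarrow> 'v" where
  "data_avg N S f = (1 / real N) *\<^sub>R (\<Sum>j=1..N. f (fst (S j)) (snd (S j)))"

definition h_avg :: "(real^'d \<Rightarrow> 'x \<Rightarrow> real) \<Rightarrow> (real^'d) measure \<Rightarrow> 'x \<Rightarrow> real" where
  "h_avg h \<mu> x = (LINT \<theta>|\<mu>. h \<theta> x)"

definition loss ::
  "(real \<Rightarrow> real) \<Rightarrow> (real^'d \<Rightarrow> 'x \<Rightarrow> real) \<Rightarrow> nat \<Rightarrow> (nat \<Rightarrow> 'x \<times> real) \<Rightarrow> (real^'d) measure \<Rightarrow> real" where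
  "loss l h N S \<mu> = data_avg N S (\<lambda>x y. l (- y * h_avg h \<mu> x))"

definition s_fun ::
  "(real \<Rightarrow> real) \<Rightarrow> (real^'d \<Rightarrow> 'x \<Rightarrow> real) \<Rightarrow> (real^'d) measure \<Rightarrow> real^'d \<Rightarrow> 'x \<Rightarrow> real \<Rightarrow> real^'d" where
  "s_fun l h \<mu> \<theta> x y = (- deriv l (- y * h_avg h \<mu> x) * y) *\<^sub>R grad (\<lambda>\<tau>. h \<tau> x) \<theta>"

text \<open>In the quadratic term, \<open>T \<theta> x\<close> is the intermediate point at which the Hessian is evaluated.\<close>

definition H_term ::
  "(real \<Rightarrow> real) \<Rightarrow> (real^'d \<Rightarrow> 'x \<Rightarrow> real) \<Rightarrow> nat \<Rightarrow> (nat \<Rightarrow> 'x \<times> real) \<Rightarrow> (real^'d) measure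
    \<Rightarrow> (real^'d \<Rightarrow> 'x \<Rightarrow> real^'d) \<Rightarrow> (real^'d \<Rightarrow> real^'d) \<Rightarrow> real" where
  "H_term l h N S \<mu> T \<xi> =
     - data_avg N S (\<lambda>x y. y * deriv l (- y * h_avg h \<mu> x) *
          (LINT \<theta>|on_supp \<mu>. norm_sq_wrt (hess (\<lambda>\<tau>. h \<tau> x) (T \<theta> x)) (\<xi> \<theta>)))
     + data_avg N S (\<lambda>x y. deriv (deriv l) (- y * h_avg h \<mu> x) *
          (LINT \<theta>|on_supp \<mu>. grad (\<lambda>\<tau>. h \<tau> x) \<theta> \<bullet> \<xi> \<theta>)\<^sup>2)"

end

theory Submission
  imports Defs
begin

text \<open>
  Taylor's formula in \<open>\<theta>\<close> with Lagrange remainder shows that the push-forward changes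
  \<open>h\<^sub>\<mu>(x)\<close> by \<open>A + B/2\<close>, where \<open>A = E\<^sub>\<mu>[\<nabla>h \<bullet> \<xi>]\<close> is \<open>O(\<parallel>\<xi>\<parallel>)\<close> and the Hessian term \<open>B\<close> is \<open>O(\<parallel>\<xi>\<parallel>\<^sup>2)\<close>.
  Inserting this into the second-order expansion of \<open>l\<close> at \<open>-y h\<^sub>\<mu>(x)\<close>, the error consists of the
  Peano remainder and of \<open>l''/2 * ((A + B/2)\<^sup>2 - A\<^sup>2) = O(\<parallel>\<xi>\<parallel>\<^sup>3)\<close>. No measurability of the intermediate
  point is needed: Taylor's formula expresses the Hessian integrand through measurable functions.
\<close>

section \<open>Gradients, Hessians and Taylor's formula in several variables\<close>

text \<open>Since \<open>grad\<close> is a definite description, it is meaningful only once a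
  representing vector is known to exist and to be unique. The Riesz vector \<open>D\<close>,
  assembled from the values of the derivative on the basis, gives existence; uniqueness follows from
  that of the derivative.\<close>

lemma GDERIV_grad:
  assumes "f differentiable (at \<theta>)"
  shows "GDERIV f \<theta> :> grad f \<theta>"
proof -
  from assms obtain f' where f': "(f has_derivative f') (at \<theta>)"
    by (auto simp: differentiable_def)
  then interpret f': bounded_linear f' by (rule has_derivative_bounded_linear)
  define D where "D = (\<Sum>b\<in>Basis. f' b *\<^sub>R b)"
  have "f' v = v \<bullet> D" for v
  proof -
    have "f' v = f' (\<Sum>b\<in>Basis. (v \<bullet> b) *\<^sub>R b)" by (simp add: euclidean_representation)
    also have "\<dots> = v \<bullet> D" by (simp add: f'.sum f'.scaleR D_def inner_sum_right mult.commute)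
    finally show ?thesis .
  qed
  with f' have D: "GDERIV f \<theta> :> D" by (simp add: gderiv_def has_derivative_eq_rhs fun_eq_iff)
  have "E = D" if "GDERIV f \<theta> :> E" for E
  proof -
    have "(\<lambda>v. v \<bullet> E) = (\<lambda>v. v \<bullet> D)"
      using that D unfolding gderiv_def by (rule has_derivative_unique)
    then have "\<forall>v. v \<bullet> E = v \<bullet> D" by (rule fun_cong[THEN allI])
    then show ?thesis by (rule vector_eq_ldot[THEN iffD1])
  qed
  with D have "grad f \<theta> = D" unfolding grad_def by (rule the_equality)
  with D show ?thesis by simp
qed

lemma hess_has_derivative:
  assumes "grad f differentiable (at \<theta>)"
  shows "(grad f has_derivative (\<lambda>v. hess f \<theta> *v v)) (at \<theta>)"
  using assms unfolding hess_def by (rule iffD1[OF jacobian_works])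

lemma C2_multi_continuous:
  assumes "C2_multi f"
  shows "continuous_on UNIV f" "continuous_on UNIV (grad f)"
  using assms unfolding C2_multi_def
  by (auto intro!: continuous_at_imp_continuous_on differentiable_imp_continuous_within)

text \<open>The problem is restricted to the line through \<theta> in direction \<open>v\<close>,
  where the one-dimensional Maclaurin formula of order 2 with Lagrange remainder applies at
  parameter 1.\<close>

lemma C2_multi_Taylor:
  assumes "C2_multi f"
  shows "\<exists>\<tau>\<in>closed_segment \<theta> (\<theta> + v).
    f (\<theta> + v) = f \<theta> + grad f \<theta> \<bullet> v + 1/2 * norm_sq_wrt (hess f \<tau>) v"
proof -
  \<comment> \<open>These are the derivatives of orders 0, 1 and 2 along the line. Indices above 2
    are never evaluated, so their value is immaterial.\<close>
  define diff :: "nat \<Rightarrow> real \<Rightarrow> real" where "diff m t =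
    (if m = 0 then f (\<theta> + t *\<^sub>R v) else if m = 1 then grad f (\<theta> + t *\<^sub>R v) \<bullet> v
     else norm_sq_wrt (hess f (\<theta> + t *\<^sub>R v)) v)" for m t
  have line: "((\<lambda>t. \<theta> + t *\<^sub>R v) has_derivative (\<lambda>s. s *\<^sub>R v)) (at t)" for t
    by (auto intro!: derivative_eq_intros)
  have f: "(f has_derivative (\<lambda>w. w \<bullet> grad f \<tau>)) (at \<tau>)" for \<tau>
    using GDERIV_grad[of f \<tau>] assms by (auto simp: C2_multi_def gderiv_def)
  have g: "(grad f has_derivative (\<lambda>w. hess f \<tau> *v w)) (at \<tau>)" for \<tau>
    using assms by (auto simp: C2_multi_def intro: hess_has_derivative)
  have 0: "DERIV (diff 0) t :> diff (Suc 0) t" for t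
    using has_derivative_compose[OF line f]
    by (simp add: diff_def[abs_def] has_field_derivative_def inner_commute mult.commute[of _ "_ \<bullet> _"])
  have 1: "DERIV (diff (Suc 0)) t :> diff (Suc (Suc 0)) t" for t
    using has_derivative_inner_left[OF has_derivative_compose[OF line g], of v t]
    by (simp add: diff_def[abs_def] has_field_derivative_def norm_sq_wrt_def inner_commute
        matrix_vector_mult_scaleR mult.commute[of _ "_ \<bullet> _"])
  have "\<forall>m t. m < 2 \<and> 0 \<le> t \<and> t \<le> 1 \<longrightarrow> DERIV (diff m) t :> diff (Suc m) t"
    using 0 1 by (auto simp: less_2_cases_iff)
  from Maclaurin[OF _ _ refl this] obtain t where t: "0 < t" "t < 1"
    and eq: "diff 0 1 = (\<Sum>m<2. (diff m 0 / fact m) * 1 ^ m) + (diff 2 t / fact 2) * 1 ^ 2"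
    by auto
  have "\<theta> + t *\<^sub>R v \<in> closed_segment \<theta> (\<theta> + v)"
    using t unfolding in_segment by (intro exI[of _ t]) (auto simp: algebra_simps)
  moreover have "f (\<theta> + v) = f \<theta> + grad f \<theta> \<bullet> v + 1/2 * norm_sq_wrt (hess f (\<theta> + t *\<^sub>R v)) v"
    using eq by (simp add: diff_def numeral_2_eq_2)
  ultimately show ?thesis by blast
qed

text \<open>A bound on the matrix norm bounds every entry, hence the operator norm up to the crude
  factor \<open>CARD('d)\<close> squared; Cauchy-Schwarz then controls the quadratic form. This
  yields one constant for all Hessians at once.\<close>

lemma norm_sq_wrt_bounded:
  fixes \<H> :: "(real^'d^'d) set"
  assumes "bounded \<H>"
  shows "\<exists>K. \<forall>A\<in>\<H>. \<forall>v. \<bar>norm_sq_wrt A v\<bar> \<le> K * (norm v)\<^sup>2"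
proof -
  obtain B where B: "\<And>A. A \<in> \<H> \<Longrightarrow> norm A \<le> B"
    using assms unfolding bounded_iff by blast
  define K where "K = real CARD('d) * real CARD('d) * B"
  have "\<bar>norm_sq_wrt A v\<bar> \<le> K * (norm v)\<^sup>2" if "A \<in> \<H>" for A v
  proof -
    have "\<bar>A $ i $ j\<bar> \<le> B" for i j
      using B[OF that] Finite_Cartesian_Product.norm_nth_le[of A i] component_le_norm_cart[of "A $ i" j]
      by linarith
    then have "onorm ((*v) A) \<le> K" unfolding K_def by (rule onorm_le_matrix_component)
    then have "norm (A *v v) \<le> K * norm v"
      using onorm[OF matrix_vector_mul_bounded_linear, of A v] by (meson mult_right_mono norm_ge_zero order_trans)
    then have "norm v * norm (A *v v) \<le> norm v * (K * norm v)"
      by (intro mult_left_mono) auto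
    then show ?thesis
      using Cauchy_Schwarz_ineq2[of v "A *v v"] by (simp add: norm_sq_wrt_def power2_eq_square mult_ac)
  qed
  then show ?thesis by blast
qed

section \<open>Second-order expansion of the scalar loss\<close>

text \<open>In the Lagrange form the error is half the change of \<open>deriv (deriv l)\<close>
  between \<open>c\<close> and a point at distance at most |u|, times \<open>u\<^sup>2\<close>;
  continuity at \<open>c\<close> makes this change small. The filter is \<open>nhds 0\<close>, not a
  punctured neighbourhood, so that increments equal to zero may be substituted later.\<close>

lemma C2_real_Peano:
  assumes "C2_real l"
  shows "(\<lambda>u. l (c + u) - l c - deriv l c * u - 1/2 * deriv (deriv l) c * u\<^sup>2) \<in> o[nhds 0](\<lambda>u. u\<^sup>2)"
proof (rule landau_o.smallI)
  fix e :: real assume e: "e > 0"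
  have d1: "(l has_real_derivative deriv l t) (at t)"
    and d2: "(deriv l has_real_derivative deriv (deriv l) t) (at t)" for t
    using assms by (auto simp: C2_real_def DERIV_deriv_iff_real_differentiable)
  have "isCont (deriv (deriv l)) c"
    using assms by (auto simp: C2_real_def continuous_on_eq_continuous_at)
  then obtain d where d: "d > 0" "\<And>t. \<bar>t - c\<bar> < d \<Longrightarrow> \<bar>deriv (deriv l) t - deriv (deriv l) c\<bar> < e"
    using e unfolding continuous_at_eps_delta dist_real_def by blast
  define diff :: "nat \<Rightarrow> real \<Rightarrow> real" where "diff m t =
    (if m = 0 then l (c + t) else if m = 1 then deriv l (c + t) else deriv (deriv l) (c + t))" for m t
  have 0: "DERIV (diff 0) t :> diff (Suc 0) t" "DERIV (diff (Suc 0)) t :> diff (Suc (Suc 0)) t" for t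
    using DERIV_shift[of l "deriv l (c + t)" t c] DERIV_shift[of "deriv l" "deriv (deriv l) (c + t)" t c]
      d1[of "t + c"] d2[of "t + c"]
    by (auto simp: diff_def[abs_def] add.commute)
  have "\<bar>l (c + u) - l c - deriv l c * u - 1/2 * deriv (deriv l) c * u\<^sup>2\<bar> \<le> e * u\<^sup>2" if "\<bar>u\<bar> < d" for u
  proof -
    have "\<forall>m t. m < 2 \<and> \<bar>t\<bar> \<le> \<bar>u\<bar> \<longrightarrow> DERIV (diff m) t :> diff (Suc m) t"
      using 0 by (auto simp: less_2_cases_iff)
    from Maclaurin_bi_le[OF refl this] obtain t where t: "\<bar>t\<bar> \<le> \<bar>u\<bar>"
      and "l (c + u) = l c + deriv l c * u + 1/2 * deriv (deriv l) (c + t) * u\<^sup>2"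
      by (auto simp: diff_def numeral_2_eq_2)
    then have "l (c + u) - l c - deriv l c * u - 1/2 * deriv (deriv l) c * u\<^sup>2
        = 1/2 * (deriv (deriv l) (c + t) - deriv (deriv l) c) * u\<^sup>2"
      by (simp add: algebra_simps)
    also have "\<bar>\<dots>\<bar> = 1/2 * \<bar>deriv (deriv l) (c + t) - deriv (deriv l) c\<bar> * u\<^sup>2"
      by (simp add: abs_mult)
    also have "\<dots> \<le> e * u\<^sup>2"
      using d(2)[of "c + t"] t that by (intro mult_right_mono) auto
    finally show ?thesis .
  qed
  then show "\<forall>\<^sub>F u in nhds 0. norm (l (c + u) - l c - deriv l c * u - 1/2 * deriv (deriv l) c * u\<^sup>2)
      \<le> e * norm (u\<^sup>2)"
    unfolding eventually_nhds_metric using d(1) by (auto simp: dist_real_def)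
qed

text \<open>This models the error at a single data point: \<open>n\<close> is the \<open>L2\<close>
  norm of the perturbation, \<open>s\<close> is \<open>-y\<close>, and \<open>A + 1/2 * B\<close> is
  the change of the averaged predictor. Only \<open>A\<close> enters the quadratic term, because
  \<open>B\<close> is of smaller order than \<open>n\<close>.\<close>

lemma C2_real_remainder_smallo:
  fixes n A B :: "'a \<Rightarrow> real"
  assumes l: "C2_real l" and s: "s\<^sup>2 = 1"
    and n: "(n \<longlongrightarrow> 0) F" and A: "A \<in> O[F](n)" and B: "B \<in> O[F](\<lambda>\<xi>. (n \<xi>)\<^sup>2)"
  shows "(\<lambda>\<xi>. l (c + s * (A \<xi> + 1/2 * B \<xi>)) - l c - s * deriv l c * (A \<xi> + 1/2 * B \<xi>)
      - 1/2 * deriv (deriv l) c * (A \<xi>)\<^sup>2) \<in> o[F](\<lambda>\<xi>. (n \<xi>)\<^sup>2)"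
proof -
  define u where "u \<xi> = s * (A \<xi> + 1/2 * B \<xi>)" for \<xi>
  \<comment> \<open>As \<open>n\<close> tends to 0, its square is o(n). Hence \<open>B\<close> is
    o(n), and the full increment \<open>u\<close> is O(n) and tends to 0.\<close>
  have n1: "n \<in> o[F](\<lambda>_. 1)" using n by (simp add: smalloI_tendsto)
  then have "(\<lambda>\<xi>. n \<xi> * n \<xi>) \<in> o[F](\<lambda>\<xi>. n \<xi> * 1)" by (intro landau_o.big_small_mult) auto
  then have n2: "(\<lambda>\<xi>. (n \<xi>)\<^sup>2) \<in> o[F](n)" by (simp add: power2_eq_square)
  have Bn: "B \<in> o[F](n)" using B n2 by (rule landau_o.big_small_trans)
  then have u: "u \<in> O[F](n)"
    unfolding u_def[abs_def] using A landau_o.small_imp_big[OF Bn] by (auto intro!: sum_in_bigo)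
  then have "u \<in> o[F](\<lambda>_. 1)" using n1 by (rule landau_o.big_small_trans)
  then have u0: "(u \<longlongrightarrow> 0) F" by (auto dest: smalloD_tendsto)
  have "(\<lambda>\<xi>. (u \<xi>)\<^sup>2) \<in> O[F](\<lambda>\<xi>. (n \<xi>)\<^sup>2)"
    using u by (rule landau_o.big_power)
  with landau_o.small.compose[OF C2_real_Peano[OF l, of c] u0]
  have 1: "(\<lambda>\<xi>. l (c + u \<xi>) - l c - deriv l c * u \<xi> - 1/2 * deriv (deriv l) c * (u \<xi>)\<^sup>2) \<in> o[F](\<lambda>\<xi>. (n \<xi>)\<^sup>2)"
    by (rule landau_o.small_big_trans)
  \<comment> \<open>This product is what remains of the square of \<open>A + 1/2 * B\<close> after
    removing the square of \<open>A\<close>: a factor o(n) times a factor O(n).\<close>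
  have "(\<lambda>\<xi>. B \<xi> * (A \<xi> + 1/4 * B \<xi>)) \<in> o[F](\<lambda>\<xi>. n \<xi> * n \<xi>)"
    using Bn A landau_o.small_imp_big[OF Bn] by (intro landau_o.small_big_mult sum_in_bigo) auto
  then have 2: "(\<lambda>\<xi>. 1/2 * deriv (deriv l) c * (B \<xi> * (A \<xi> + 1/4 * B \<xi>))) \<in> o[F](\<lambda>\<xi>. (n \<xi>)\<^sup>2)"
    by (simp add: power2_eq_square)
  have "(u \<xi>)\<^sup>2 = (A \<xi>)\<^sup>2 + B \<xi> * (A \<xi> + 1/4 * B \<xi>)" for \<xi>
    using s by (simp add: u_def power_mult_distrib) (simp add: power2_eq_square algebra_simps)
  then have "(\<lambda>\<xi>. l (c + s * (A \<xi> + 1/2 * B \<xi>)) - l c - s * deriv l c * (A \<xi> + 1/2 * B \<xi>)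
      - 1/2 * deriv (deriv l) c * (A \<xi>)\<^sup>2) = (\<lambda>\<xi>.
        (l (c + u \<xi>) - l c - deriv l c * u \<xi> - 1/2 * deriv (deriv l) c * (u \<xi>)\<^sup>2) +
        1/2 * deriv (deriv l) c * (B \<xi> * (A \<xi> + 1/4 * B \<xi>)))"
    by (simp add: fun_eq_iff u_def algebra_simps)
  then show ?thesis using sum_in_smallo(1)[OF 1 2] by simp
qed

section \<open>The support of a measure and integration over it\<close>

lemma closed_supp: "closed (supp \<mu>)"
proof -
  have "- supp \<mu> = \<Union>{U. open U \<and> emeasure \<mu> U = 0}"
    by (auto simp: supp_def not_gr_zero)
  then show ?thesis by (simp add: closed_def open_Union)
qed

text \<open>The complement of the support is a union of possibly uncountably many open null sets. By
  the Lindelof property countably many of them already cover it, so it is itself null.\<close>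

lemma AE_supp:
  assumes "sets \<mu> = sets borel"
  shows "AE \<theta> in \<mu>. \<theta> \<in> supp \<mu>"
proof -
  obtain \<B> where \<B>: "\<And>U. U \<in> \<B> \<Longrightarrow> open U \<and> emeasure \<mu> U = 0"
      "countable \<B>" "\<Union>\<B> = \<Union>{U. open U \<and> emeasure \<mu> U = 0}"
    using Lindelof[of "{U. open U \<and> emeasure \<mu> U = 0}"] by (auto simp: subset_iff)
  have "AE \<theta> in \<mu>. \<forall>U\<in>\<B>. \<theta> \<notin> U"
    using \<B>(1,2) assms by (auto simp: AE_ball_countable intro!: AE_not_in null_setsI)
  then show ?thesis
  proof eventually_elim
    case (elim \<theta>)
    then have "\<theta> \<notin> \<Union>{U. open U \<and> emeasure \<mu> U = 0}" using \<B>(3) by blast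
    then show ?case by (auto simp: supp_def zero_less_iff_neq_zero)
  qed
qed

text \<open>The support carries full mass, so restricting to it loses neither total mass nor the
  values of integrals. This links \<open>h_avg\<close>, an integral over \<mu>, with the integrals
  involving \<xi>, which live on \<open>on_supp \<mu>\<close>.\<close>

lemma
  assumes "\<mu> \<in> P2"
  shows prob_space_on_supp: "prob_space (on_supp \<mu>)"
    and integral_on_supp: "f \<in> borel_measurable borel \<Longrightarrow> (LINT \<theta>|on_supp \<mu>. f \<theta>) = (LINT \<theta>|\<mu>. f \<theta> :: real)"
proof -
  interpret prob_space \<mu> using assms by (simp add: P2_def)
  have sets[simp, measurable_cong]: "sets \<mu> = sets borel" using assms by (simp add: P2_def)
  have supp[measurable]: "supp \<mu> \<in> sets borel" using closed_supp by (rule borel_closed)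
  have ae: "AE \<theta> in \<mu>. \<theta> \<in> supp \<mu>" by (simp add: AE_supp)
  then have "emeasure \<mu> (supp \<mu>) = 1" by (intro emeasure_eq_1_AE) auto
  then show "prob_space (on_supp \<mu>)" unfolding on_supp_def by (intro prob_space_restrict_space) auto
  show "(LINT \<theta>|on_supp \<mu>. f \<theta>) = (LINT \<theta>|\<mu>. f \<theta> :: real)" if [measurable]: "f \<in> borel_measurable borel"
  proof -
    have "(LINT \<theta>|on_supp \<mu>. f \<theta>) = (LINT \<theta>|\<mu>. indicator (supp \<mu>) \<theta> *\<^sub>R f \<theta>)"
      unfolding on_supp_def by (rule integral_restrict_space) simp
    also have "\<dots> = (LINT \<theta>|\<mu>. f \<theta>)"
      by (rule integral_cong_AE) (use ae in \<open>auto elim: eventually_mono\<close>)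
    finally show ?thesis .
  qed
qed

lemma measurable_on_supp:
  assumes "\<mu> \<in> P2" "f \<in> measurable borel M"
  shows "f \<in> measurable (on_supp \<mu>) M"
proof -
  have "sets \<mu> = sets borel" using assms(1) by (simp add: P2_def)
  then have "f \<in> measurable \<mu> M" using assms(2) by (simp cong: measurable_cong_sets)
  then show ?thesis unfolding on_supp_def by (rule measurable_restrict_space1)
qed

lemma
  assumes "\<mu> \<in> P2" "\<xi> \<in> L2 \<mu>"
  shows L2_integrable_norm: "integrable (on_supp \<mu>) (\<lambda>\<theta>. norm (\<xi> \<theta>))"
    and L2_norm_squared: "(L2_norm \<mu> \<xi>)\<^sup>2 = (LINT \<theta>|on_supp \<mu>. (norm (\<xi> \<theta>))\<^sup>2)"
    and L1_le_L2_norm: "(LINT \<theta>|on_supp \<mu>. norm (\<xi> \<theta>)) \<le> L2_norm \<mu> \<xi>"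
proof -
  interpret prob_space "on_supp \<mu>" using assms(1) by (rule prob_space_on_supp)
  have meas: "\<xi> \<in> borel_measurable (on_supp \<mu>)" and sq: "integrable (on_supp \<mu>) (\<lambda>\<theta>. (norm (\<xi> \<theta>))\<^sup>2)"
    using assms(2) by (auto simp: L2_def)
  show int: "integrable (on_supp \<mu>) (\<lambda>\<theta>. norm (\<xi> \<theta>))"
    using measurable_compose[OF meas borel_measurable_norm] sq by (rule square_integrable_imp_integrable)
  show eq: "(L2_norm \<mu> \<xi>)\<^sup>2 = (LINT \<theta>|on_supp \<mu>. (norm (\<xi> \<theta>))\<^sup>2)"
    by (simp add: L2_norm_def L2_inner_def power2_norm_eq_inner)
  \<comment> \<open>Nonnegativity of the variance of the norm of \<xi> is the comparison of the
    first and second moments.\<close>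
  have "(expectation (\<lambda>\<theta>. norm (\<xi> \<theta>)))\<^sup>2 \<le> (L2_norm \<mu> \<xi>)\<^sup>2"
    using variance_positive[of "\<lambda>\<theta>. norm (\<xi> \<theta>)"] variance_eq[OF int sq] eq by linarith
  then show "(LINT \<theta>|on_supp \<mu>. norm (\<xi> \<theta>)) \<le> L2_norm \<mu> \<xi>"
    by (rule power2_le_imp_le) (simp add: L2_norm_def L2_inner_def)
qed

lemma tendsto_L2_norm: "(L2_norm \<mu> \<longlongrightarrow> 0) (L2_to_0 \<mu>)"
  unfolding L2_to_0_def by (rule tendsto_mono[OF inf_le1 filterlim_filtercomap])

lemma eventually_L2: "\<forall>\<^sub>F \<xi> in L2_to_0 \<mu>. \<xi> \<in> L2 \<mu>"
  unfolding L2_to_0_def by (auto simp: eventually_inf_principal)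

section \<open>Averages over the dataset\<close>

lemma data_avg_cong:
  "(\<And>j. j \<in> {1..N} \<Longrightarrow> f (fst (S j)) (snd (S j)) = g (fst (S j)) (snd (S j))) \<Longrightarrow> data_avg N S f = data_avg N S g"
  by (simp add: data_avg_def)

lemma data_avg_add: "data_avg N S (\<lambda>x y. f x y + g x y) = data_avg N S f + data_avg N S g"
  by (simp add: data_avg_def sum.distrib algebra_simps)

lemma data_avg_mult_left: "data_avg N S (\<lambda>x y. c * f x y :: real) = c * data_avg N S f"
  by (simp add: data_avg_def sum_distrib_left mult_ac)

lemma integral_data_avg_inner:
  assumes "\<And>j. j \<in> {1..N} \<Longrightarrow> integrable M (\<lambda>\<theta>. f \<theta> (fst (S j)) (snd (S j)) \<bullet> \<xi> \<theta>)"
  shows "(LINT \<theta>|M. data_avg N S (f \<theta>) \<bullet> \<xi> \<theta>) = data_avg N S (\<lambda>x y. LINT \<theta>|M. f \<theta> x y \<bullet> \<xi> \<theta>)"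
  using assms by (simp add: data_avg_def inner_sum_left)

lemma data_avg_bigo:
  fixes f :: "'a \<Rightarrow> 'x \<Rightarrow> real \<Rightarrow> real"
  assumes "\<And>j. j \<in> {1..N} \<Longrightarrow> (\<lambda>\<xi>. f \<xi> (fst (S j)) (snd (S j))) \<in> O[F](g)"
  shows "(\<lambda>\<xi>. data_avg N S (f \<xi>)) \<in> O[F](g)"
  \<comment> \<open>For \<open>N = 0\<close> the sum is empty and the average is 0; otherwise
    \<open>1 / real N\<close> is a nonzero constant factor, which leaves the growth class
    unchanged.\<close>
  using assms by (cases "N = 0") (auto simp: data_avg_def intro!: big_sum_in_bigo)

lemma data_avg_smallo:
  fixes f :: "'a \<Rightarrow> 'x \<Rightarrow> real \<Rightarrow> real"
  assumes "\<And>j. j \<in> {1..N} \<Longrightarrow> (\<lambda>\<xi>. f \<xi> (fst (S j)) (snd (S j))) \<in> o[F](g)"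
  shows "(\<lambda>\<xi>. data_avg N S (f \<xi>)) \<in> o[F](g)"
  using assms by (cases "N = 0") (auto simp: data_avg_def intro!: big_sum_in_smallo)

section \<open>Expectation of one smooth function under the perturbed measure\<close>

text \<open>Here \<open>f\<close> stands for \<open>h\<close> at a fixed data point and \<tau> for
  any choice of Taylor points. The linear term is controlled by the first moment of \<xi>, hence by
  its \<open>L2\<close> norm, and the Hessian term by the second moment. Boundedness of
  \<open>f\<close> makes it integrable, so Taylor's formula can be integrated term by term.\<close>

lemma
  assumes \<mu>: "\<mu> \<in> P2" and \<xi>: "\<xi> \<in> L2 \<mu>" and f: "C2_multi f"
    and f_le: "\<And>\<theta>. \<bar>f \<theta>\<bar> \<le> C"
    and G: "\<And>\<theta>. norm (grad f \<theta>) \<le> G"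
    and K: "\<And>\<theta> v. \<bar>norm_sq_wrt (hess f \<theta>) v\<bar> \<le> K * (norm v)\<^sup>2"
    and \<tau>: "\<And>\<theta>. f (\<theta> + \<xi> \<theta>) = f \<theta> + grad f \<theta> \<bullet> \<xi> \<theta> + 1/2 * norm_sq_wrt (hess f (\<tau> \<theta>)) (\<xi> \<theta>)"
  shows integrable_grad_inner: "integrable (on_supp \<mu>) (\<lambda>\<theta>. grad f \<theta> \<bullet> \<xi> \<theta>)"
    and integrable_norm_sq_wrt_hess: "integrable (on_supp \<mu>) (\<lambda>\<theta>. norm_sq_wrt (hess f (\<tau> \<theta>)) (\<xi> \<theta>))"
    and integral_grad_inner_le: "\<bar>LINT \<theta>|on_supp \<mu>. grad f \<theta> \<bullet> \<xi> \<theta>\<bar> \<le> G * L2_norm \<mu> \<xi>"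
    and integral_norm_sq_wrt_hess_le:
      "\<bar>LINT \<theta>|on_supp \<mu>. norm_sq_wrt (hess f (\<tau> \<theta>)) (\<xi> \<theta>)\<bar> \<le> K * (L2_norm \<mu> \<xi>)\<^sup>2"
    and integral_push_forward_Taylor: "(LINT \<theta>|push_forward (\<lambda>\<theta>. \<theta> + \<xi> \<theta>) \<mu>. f \<theta>) =
      (LINT \<theta>|\<mu>. f \<theta>) + ((LINT \<theta>|on_supp \<mu>. grad f \<theta> \<bullet> \<xi> \<theta>)
        + 1/2 * (LINT \<theta>|on_supp \<mu>. norm_sq_wrt (hess f (\<tau> \<theta>)) (\<xi> \<theta>)))"
proof -
  interpret prob_space "on_supp \<mu>" using \<mu> by (rule prob_space_on_supp)
  have [measurable]: "f \<in> borel_measurable borel" "grad f \<in> borel_measurable borel"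
    using C2_multi_continuous[OF f] by (auto intro: borel_measurable_continuous_onI)
  have [measurable]: "f \<in> borel_measurable (on_supp \<mu>)" "grad f \<in> borel_measurable (on_supp \<mu>)"
    "(\<lambda>\<theta>. \<theta>) \<in> borel_measurable (on_supp \<mu>)"
    using \<mu> by (auto intro!: measurable_on_supp)
  have [measurable]: "\<xi> \<in> borel_measurable (on_supp \<mu>)" and sq: "integrable (on_supp \<mu>) (\<lambda>\<theta>. (norm (\<xi> \<theta>))\<^sup>2)"
    using \<xi> by (auto simp: L2_def)
  note int = L2_integrable_norm[OF \<mu> \<xi>]
  have g: "\<bar>grad f \<theta> \<bullet> \<xi> \<theta>\<bar> \<le> G * norm (\<xi> \<theta>)" for \<theta>
    using Cauchy_Schwarz_ineq2[of "grad f \<theta>" "\<xi> \<theta>"] G[of \<theta>] by (meson mult_right_mono norm_ge_zero order_trans)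
  have G0: "G \<ge> 0" using G norm_ge_zero order_trans by blast
  show ig: "integrable (on_supp \<mu>) (\<lambda>\<theta>. grad f \<theta> \<bullet> \<xi> \<theta>)"
    by (rule Bochner_Integration.integrable_bound[where f = "\<lambda>\<theta>. G * norm (\<xi> \<theta>)"])
      (use int g G0 in auto)
  have Q: "norm_sq_wrt (hess f (\<tau> \<theta>)) (\<xi> \<theta>) = 2 * (f (\<theta> + \<xi> \<theta>) - f \<theta> - grad f \<theta> \<bullet> \<xi> \<theta>)" for \<theta>
    using \<tau>[of \<theta>] by simp
  have [measurable]: "(\<lambda>\<theta>. norm_sq_wrt (hess f (\<tau> \<theta>)) (\<xi> \<theta>)) \<in> borel_measurable (on_supp \<mu>)"
    unfolding Q by measurable
  show iQ: "integrable (on_supp \<mu>) (\<lambda>\<theta>. norm_sq_wrt (hess f (\<tau> \<theta>)) (\<xi> \<theta>))"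
    by (rule Bochner_Integration.integrable_bound[where f = "\<lambda>\<theta>. K * (norm (\<xi> \<theta>))\<^sup>2"])
      (use sq K in \<open>auto intro!: AE_I2 order_trans[OF K abs_ge_self]\<close>)
  have "\<bar>LINT \<theta>|on_supp \<mu>. grad f \<theta> \<bullet> \<xi> \<theta>\<bar> \<le> (LINT \<theta>|on_supp \<mu>. G * norm (\<xi> \<theta>))"
    using int g ig by (intro order_trans[OF integral_abs_bound] integral_mono) auto
  also have "\<dots> \<le> G * L2_norm \<mu> \<xi>"
    using L1_le_L2_norm[OF \<mu> \<xi>] G0 by (simp add: mult_left_mono)
  finally show "\<bar>LINT \<theta>|on_supp \<mu>. grad f \<theta> \<bullet> \<xi> \<theta>\<bar> \<le> G * L2_norm \<mu> \<xi>" .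
  have "\<bar>LINT \<theta>|on_supp \<mu>. norm_sq_wrt (hess f (\<tau> \<theta>)) (\<xi> \<theta>)\<bar> \<le> (LINT \<theta>|on_supp \<mu>. K * (norm (\<xi> \<theta>))\<^sup>2)"
    using sq K iQ by (intro order_trans[OF integral_abs_bound] integral_mono) auto
  then show "\<bar>LINT \<theta>|on_supp \<mu>. norm_sq_wrt (hess f (\<tau> \<theta>)) (\<xi> \<theta>)\<bar> \<le> K * (L2_norm \<mu> \<xi>)\<^sup>2"
    by (simp add: L2_norm_squared[OF \<mu> \<xi>])
  have "integrable (on_supp \<mu>) f"
    using f_le by (intro integrable_const_bound[where B = C]) auto
  then have "(LINT \<theta>|on_supp \<mu>. f (\<theta> + \<xi> \<theta>)) =
      (LINT \<theta>|on_supp \<mu>. f \<theta>) + ((LINT \<theta>|on_supp \<mu>. grad f \<theta> \<bullet> \<xi> \<theta>)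
        + 1/2 * (LINT \<theta>|on_supp \<mu>. norm_sq_wrt (hess f (\<tau> \<theta>)) (\<xi> \<theta>)))"
    unfolding \<tau> using ig iQ by simp
  moreover have "(LINT \<theta>|push_forward (\<lambda>\<theta>. \<theta> + \<xi> \<theta>) \<mu>. f \<theta>) = (LINT \<theta>|on_supp \<mu>. f (\<theta> + \<xi> \<theta>))"
    unfolding push_forward_def by (rule integral_distr) auto
  ultimately show "(LINT \<theta>|push_forward (\<lambda>\<theta>. \<theta> + \<xi> \<theta>) \<mu>. f \<theta>) =
      (LINT \<theta>|\<mu>. f \<theta>) + ((LINT \<theta>|on_supp \<mu>. grad f \<theta> \<bullet> \<xi> \<theta>)
        + 1/2 * (LINT \<theta>|on_supp \<mu>. norm_sq_wrt (hess f (\<tau> \<theta>)) (\<xi> \<theta>)))"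
    by (simp add: integral_on_supp[OF \<mu>])
qed

section \<open>Second-order expansion of the empirical loss\<close>

theorem proposition3:
  fixes X :: "(real^'n) set"
    and h :: "real^'d \<Rightarrow> real^'n \<Rightarrow> real"
    and l :: "real \<Rightarrow> real"
    and N :: nat
    and S :: "nat \<Rightarrow> (real^'n) \<times> real"
    and \<mu> :: "(real^'d) measure"
  assumes "X \<in> sets borel"
    and "\<And>\<theta> x. x \<in> X \<Longrightarrow> h \<theta> x \<in> {-1..1}"
    and "case_prod h \<in> borel_measurable (restrict_space borel (UNIV \<times> X))"
    and "\<And>\<theta>. continuous_on X (h \<theta>)"
    and "N \<ge> 1"
    and "\<And>j. j \<in> {1..N} \<Longrightarrow> S j \<in> X \<times> {-1, 1}"
    and "C2_real l"
    and "\<And>x. x \<in> X \<Longrightarrow> C2_multi (\<lambda>\<theta>. h \<theta> x)"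
    and "bounded {grad (\<lambda>\<tau>. h \<tau> x) \<theta> | \<theta> x. x \<in> X}"
    and "bounded {hess (\<lambda>\<tau>. h \<tau> x) \<theta> | \<theta> x. x \<in> X}"
    and "bounded {c. \<exists>\<theta> x. x \<in> X \<and> is_eigenvalue (hess (\<lambda>\<tau>. h \<tau> x) \<theta>) c}"
    and "\<mu> \<in> P2"
  shows "\<exists>T r.
     (\<forall>\<xi>\<in>L2 \<mu>.
        (\<forall>\<theta>\<in>supp \<mu>. \<forall>x\<in>X. T \<xi> \<theta> x \<in> closed_segment \<theta> (\<theta> + \<xi> \<theta>)) \<and>
        (\<forall>x\<in>X. integrable (on_supp \<mu>) (\<lambda>\<theta>. norm_sq_wrt (hess (\<lambda>\<tau>. h \<tau> x) (T \<xi> \<theta> x)) (\<xi> \<theta>))) \<and>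
        loss l h N S (push_forward (\<lambda>\<theta>. \<theta> + \<xi> \<theta>) \<mu>) =
          loss l h N S \<mu>
          + (LINT \<theta>|on_supp \<mu>. data_avg N S (\<lambda>x y. s_fun l h \<mu> \<theta> x y) \<bullet> \<xi> \<theta>)
          + 1 / 2 * H_term l h N S \<mu> (T \<xi>) \<xi>
          + r \<xi>) \<and>
     (\<lambda>\<xi>. H_term l h N S \<mu> (T \<xi>) \<xi>) \<in> O[L2_to_0 \<mu>](\<lambda>\<xi>. (L2_norm \<mu> \<xi>)\<^sup>2) \<and>
     r \<in> o[L2_to_0 \<mu>](\<lambda>\<xi>. (L2_norm \<mu> \<xi>)\<^sup>2)"
proof -
  have h_le: "\<bar>h \<theta> x\<bar> \<le> 1" if "x \<in> X" for \<theta> x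
    using assms(2)[OF that, of \<theta>] by auto
  obtain G where G: "\<And>\<theta> x. x \<in> X \<Longrightarrow> norm (grad (\<lambda>\<tau>. h \<tau> x) \<theta>) \<le> G"
    using assms(9) unfolding bounded_iff by blast
  obtain K where "\<forall>A\<in>{hess (\<lambda>\<tau>. h \<tau> x) \<theta> | \<theta> x. x \<in> X}. \<forall>v. \<bar>norm_sq_wrt A v\<bar> \<le> K * (norm v)\<^sup>2"
    using norm_sq_wrt_bounded[OF assms(10)] ..
  then have K: "\<bar>norm_sq_wrt (hess (\<lambda>\<tau>. h \<tau> x) \<theta>) v\<bar> \<le> K * (norm v)\<^sup>2" if "x \<in> X" for \<theta> x v
    using that by blast
  \<comment> \<open>One choice function covers all \<xi>, \<theta> and \<open>x\<close>, so that the
    quadratic term is a single function of \<xi> and its order of growth is meaningful. Segment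
    membership and Taylor's formula are selected together, so they hold at the same point.\<close>
  define T where "T \<xi> \<theta> x = (SOME \<tau>. \<tau> \<in> closed_segment \<theta> (\<theta> + \<xi> \<theta>) \<and>
      h (\<theta> + \<xi> \<theta>) x = h \<theta> x + grad (\<lambda>\<tau>. h \<tau> x) \<theta> \<bullet> \<xi> \<theta>
        + 1/2 * norm_sq_wrt (hess (\<lambda>\<tau>. h \<tau> x) \<tau>) (\<xi> \<theta>))"
    for \<xi> :: "real^'d \<Rightarrow> real^'d" and \<theta> x
  have "T \<xi> \<theta> x \<in> closed_segment \<theta> (\<theta> + \<xi> \<theta>) \<and>
      h (\<theta> + \<xi> \<theta>) x = h \<theta> x + grad (\<lambda>\<tau>. h \<tau> x) \<theta> \<bullet> \<xi> \<theta>
        + 1/2 * norm_sq_wrt (hess (\<lambda>\<tau>. h \<tau> x) (T \<xi> \<theta> x)) (\<xi> \<theta>)" if "x \<in> X" for \<xi> \<theta> x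
    unfolding T_def
    by (rule someI_ex, fold Bex_def, rule C2_multi_Taylor[OF assms(8)[OF that]])
  note T = this[THEN conjunct1] this[THEN conjunct2]
  define A where "A \<xi> x = (LINT \<theta>|on_supp \<mu>. grad (\<lambda>\<tau>. h \<tau> x) \<theta> \<bullet> \<xi> \<theta>)" for \<xi> x
  define B where "B \<xi> x = (LINT \<theta>|on_supp \<mu>. norm_sq_wrt (hess (\<lambda>\<tau>. h \<tau> x) (T \<xi> \<theta> x)) (\<xi> \<theta>))" for \<xi> x
  \<comment> \<open>The hypotheses of the estimates for one smooth function, with bound 1 on
    \<open>h\<close>; the gap is for membership of \<xi> in \<open>L2 \<mu>\<close>.\<close>
  note Taylor = assms(12) _ assms(8) h_le G K T(2)
  define c where "c x y = - y * h_avg h \<mu> x" for x y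
  \<comment> \<open>The remainder is given explicitly as the average of the errors at the data
    points, in the shape of \<open>C2_real_remainder_smallo\<close> with \<open>s = -y\<close>. Its
    smallness is then immediate, and the expansion becomes an identity to verify.\<close>
  define r where "r \<xi> = data_avg N S (\<lambda>x y. l (c x y + - y * (A \<xi> x + 1/2 * B \<xi> x)) - l (c x y)
      - (- y) * deriv l (c x y) * (A \<xi> x + 1/2 * B \<xi> x)
      - 1/2 * deriv (deriv l) (c x y) * (A \<xi> x)\<^sup>2)" for \<xi>
  have S: "fst (S j) \<in> X" "(- snd (S j))\<^sup>2 = 1" if "j \<in> {1..N}" for j
    using assms(6)[OF that] by auto
  have H: "H_term l h N S \<mu> (T \<xi>) \<xi> = data_avg N S (\<lambda>x y. (- y) * deriv l (c x y) * B \<xi> x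
      + deriv (deriv l) (c x y) * (A \<xi> x)\<^sup>2)" for \<xi>
  proof -
    have "- data_avg N S (\<lambda>x y. y * deriv l (c x y) * B \<xi> x)
        = data_avg N S (\<lambda>x y. (- y) * deriv l (c x y) * B \<xi> x)"
      by (simp add: data_avg_def sum_negf)
    then show ?thesis unfolding data_avg_add by (simp only: H_term_def A_def B_def c_def)
  qed
  have integrable_hess: "integrable (on_supp \<mu>) (\<lambda>\<theta>. norm_sq_wrt (hess (\<lambda>\<tau>. h \<tau> x) (T \<xi> \<theta> x)) (\<xi> \<theta>))"
    if "\<xi> \<in> L2 \<mu>" "x \<in> X" for \<xi> x
    using that by (intro integrable_norm_sq_wrt_hess[OF Taylor]) auto
  have expansion: "loss l h N S (push_forward (\<lambda>\<theta>. \<theta> + \<xi> \<theta>) \<mu>) = loss l h N S \<mu>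
      + (LINT \<theta>|on_supp \<mu>. data_avg N S (\<lambda>x y. s_fun l h \<mu> \<theta> x y) \<bullet> \<xi> \<theta>)
      + 1 / 2 * H_term l h N S \<mu> (T \<xi>) \<xi> + r \<xi>" if \<xi>: "\<xi> \<in> L2 \<mu>" for \<xi>
  proof -
    have push: "h_avg h (push_forward (\<lambda>\<theta>. \<theta> + \<xi> \<theta>) \<mu>) x = h_avg h \<mu> x + (A \<xi> x + 1/2 * B \<xi> x)"
      if "x \<in> X" for x
      unfolding h_avg_def A_def B_def using that \<xi> by (intro integral_push_forward_Taylor[OF Taylor]) auto
    have int: "integrable (on_supp \<mu>) (\<lambda>\<theta>. grad (\<lambda>\<tau>. h \<tau> x) \<theta> \<bullet> \<xi> \<theta>)" if "x \<in> X" for x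
      using that \<xi> by (intro integrable_grad_inner[OF Taylor]) auto
    \<comment> \<open>The scalar factor in \<open>s_fun\<close> does not depend on \<theta>, so
      after exchanging the finite average with the integral only \<open>A\<close> is left under
      it.\<close>
    have "(LINT \<theta>|on_supp \<mu>. data_avg N S (\<lambda>x y. s_fun l h \<mu> \<theta> x y) \<bullet> \<xi> \<theta>)
        = data_avg N S (\<lambda>x y. LINT \<theta>|on_supp \<mu>. s_fun l h \<mu> \<theta> x y \<bullet> \<xi> \<theta>)"
      using int S(1) by (intro integral_data_avg_inner) (auto simp: s_fun_def)
    also have "\<dots> = data_avg N S (\<lambda>x y. - y * deriv l (c x y) * A \<xi> x)"
      by (simp add: s_fun_def A_def c_def mult.commute)
    finally have linear: "(LINT \<theta>|on_supp \<mu>. data_avg N S (\<lambda>x y. s_fun l h \<mu> \<theta> x y) \<bullet> \<xi> \<theta>)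
        = data_avg N S (\<lambda>x y. - y * deriv l (c x y) * A \<xi> x)" .
    \<comment> \<open>With all terms collected into one average over the data, the identity holds
      summand by summand: the expansion terms subtracted in \<open>r\<close> cancel.\<close>
    show ?thesis
      unfolding loss_def linear H r_def data_avg_mult_left[symmetric] data_avg_add[symmetric]
      by (rule data_avg_cong) (simp add: push S(1) c_def algebra_simps)
  qed
  \<comment> \<open>The filter \<open>L2_to_0 \<mu>\<close> is concentrated on
    \<open>L2 \<mu>\<close>, so the integral estimate holds eventually, with constant
    \<open>G\<close>.\<close>
  have A: "(\<lambda>\<xi>. A \<xi> x) \<in> O[L2_to_0 \<mu>](L2_norm \<mu>)" if "x \<in> X" for x
  proof (rule bigoI)
    show "\<forall>\<^sub>F \<xi> in L2_to_0 \<mu>. norm (A \<xi> x) \<le> G * norm (L2_norm \<mu> \<xi>)"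
      using eventually_L2
    proof eventually_elim
      case (elim \<xi>)
      have "\<bar>A \<xi> x\<bar> \<le> G * L2_norm \<mu> \<xi>"
        unfolding A_def using that elim by (intro integral_grad_inner_le[OF Taylor]) auto
      then show ?case by (simp add: L2_norm_def L2_inner_def)
    qed
  qed
  have B: "(\<lambda>\<xi>. B \<xi> x) \<in> O[L2_to_0 \<mu>](\<lambda>\<xi>. (L2_norm \<mu> \<xi>)\<^sup>2)" if "x \<in> X" for x
  proof (rule bigoI)
    show "\<forall>\<^sub>F \<xi> in L2_to_0 \<mu>. norm (B \<xi> x) \<le> K * norm ((L2_norm \<mu> \<xi>)\<^sup>2)"
      using eventually_L2
    proof eventually_elim
      case (elim \<xi>)
      have "\<bar>B \<xi> x\<bar> \<le> K * (L2_norm \<mu> \<xi>)\<^sup>2"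
        unfolding B_def using that elim by (intro integral_norm_sq_wrt_hess_le[OF Taylor]) auto
      then show ?case by simp
    qed
  qed
  \<comment> \<open>Since \<mu> is fixed, the values of \<open>deriv l\<close> and
    \<open>deriv (deriv l)\<close> at \<open>c x y\<close> are constants; what matters is the order
    of \<open>B\<close> and of the square of \<open>A\<close>.\<close>
  have "(\<lambda>\<xi>. H_term l h N S \<mu> (T \<xi>) \<xi>) \<in> O[L2_to_0 \<mu>](\<lambda>\<xi>. (L2_norm \<mu> \<xi>)\<^sup>2)"
    unfolding H
    using S(1) by (intro data_avg_bigo sum_in_bigo) (auto intro!: B landau_o.big_power A)
  moreover have "r \<in> o[L2_to_0 \<mu>](\<lambda>\<xi>. (L2_norm \<mu> \<xi>)\<^sup>2)"
    unfolding r_def[abs_def]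
    by (intro data_avg_smallo C2_real_remainder_smallo assms(7) S tendsto_L2_norm A B)
  ultimately show ?thesis
    using T(1) integrable_hess expansion by (intro exI[of _ T] exI[of _ r]) blast
qed

end
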